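(* Let $q\ge 2$ be an integer, let $\mathcal{H}$ be a Hilbert space, and let $A=(A_1,\dots,A_q)\in B(\mathcal{H})^q$ be a $q$-tuple satisfying $\big\|\sum_{k=1}^q A_k^*A_k\big\|\le 1$. Then for any positive Radon measure $\mu$ on $\mathbb{T}$, the $B(\mathcal{H})$-valued kernel $\Gamma_A[\mu]$ on $\mathbb{F}_q^+$ is positive definite.
   Context: $\mathbb{T}=\mathbb{R}/2\pi\mathbb{Z}$. For a Radon measure $\mu$ on $\mathbb{T}$, $\widehat\mu(n)=\int_{\mathbb{T}}e^{-in\theta}\,d\mu(\theta)$. $\mathbb{F}_q^+$ is the free unital semigroup on generators $s_1,\dots,s_q$ with neutral element $e$ (empty word); $|u|$ is the length of a word $u$. For a $q$-tuple $A=(A_1,\dots,A_q)$ of bounded operators on $\mathcal{H}$ and $w=s_{i_1}\cdots s_{i_n}$, set $[w](A)=A_{i_1}\cdots A_{i_n}\in B(\mathcal{H})$, and $[e](A)=Id$. Define $\Gamma_A[\mu]:\mathbb{F}_q^+\times\mathbb{F}_q^+\to B(\mathcal{H})$ by $$\Gamma_A[\mu](u,v)=\begin{cases}\widehat\mu(|u|-|v|)\,[w](A), & u=wv \text{ for some } w\in\mathbb{F}_q^+,\\ \widehat\mu(|u|-|v|)\,([w](A))^*, & v=wu\text{ for some } w\in\mathbb{F}_q^+,\\ 0,&\text{otherwise.}\end{cases}$$ Positive definite means non-negative definite: a $B(\mathcal{H})$-valued kernel $K$ is positive definite if $\sum_{i,j}\langle K(u_i,u_j)h_j,h_i\rangle\ge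 0$ for all finite families $u_i\in\mathbb{F}_q^+$, $h_i\in\mathcal{H}$. *)

theory Defs
  imports "HOL-Analysis.Analysis"
begin

text \<open>
  The class \<^class>\<open>banach\<close> supplies the norm and completeness; it is tied to the complex
  structure by \<open>scaleR_scaleC\<close> and \<open>norm_eq_sqrt_cinner\<close>. The inner product is linear in its
  first argument.
\<close>

class complex_hilbert_space = banach +
  fixes scaleC :: "complex \<Rightarrow> 'a \<Rightarrow> 'a"  (infixr \<open>*\<^sub>C\<close> 75)
    and cinner :: "'a \<Rightarrow> 'a \<Rightarrow> complex"
  assumes scaleC_add_right: "a *\<^sub>C (x + y) = a *\<^sub>C x + a *\<^sub>C y"
    and scaleC_add_left: "(a + b) *\<^sub>C x = a *\<^sub>C x + b *\<^sub>C x"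
    and scaleC_scaleC: "a *\<^sub>C (b *\<^sub>C x) = (a * b) *\<^sub>C x"
    and scaleC_one: "1 *\<^sub>C x = x"
    and scaleR_scaleC: "r *\<^sub>R x = complex_of_real r *\<^sub>C x"
    and cinner_commute: "cinner x y = cnj (cinner y x)"
    and cinner_add_left: "cinner (x + y) z = cinner x z + cinner y z"
    and cinner_scaleC_left: "cinner (a *\<^sub>C x) y = a * cinner x y"
    and cinner_self_nonneg: "0 \<le> Re (cinner x x)"
    and cinner_self_eq_zero_iff: "cinner x x = 0 \<longleftrightarrow> x = 0"
    and norm_eq_sqrt_cinner: "norm x = sqrt (Re (cinner x x))"

text \<open>
  Elements of \<open>B(H)\<close> are represented as functions \<open>'h \<Rightarrow> 'h\<close> satisfying the following predicate;
  the operator norm is \<^const>\<open>onorm\<close>.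
\<close>

definition bounded_clinear :: "('h::complex_hilbert_space \<Rightarrow> 'h) \<Rightarrow> bool" where
  "bounded_clinear T \<longleftrightarrow> bounded_linear T \<and> (\<forall>c x. T (c *\<^sub>C x) = c *\<^sub>C T x)"

text \<open>
  For a bounded operator the described function exists by the Riesz representation theorem.
\<close>

definition cadjoint :: "('h::complex_hilbert_space \<Rightarrow> 'h) \<Rightarrow> 'h \<Rightarrow> 'h" where
  "cadjoint T = (THE S. \<forall>x y. cinner (T x) y = cinner x (S y))"

quotient_type circle = real / "\<lambda>x y. \<exists>k::int. x - y = 2 * pi * of_int k"
proof (rule equivpI)
  show "reflp (\<lambda>x y. \<exists>k::int. x - y = 2 * pi * of_int k)"
    by (rule reflpI) (auto intro: exI[of _ 0])
  show "symp (\<lambda>x y. \<exists>k::int. x - y = 2 * pi * of_int k)"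
  proof (rule sympI)
    fix x y :: real
    assume "\<exists>k::int. x - y = 2 * pi * of_int k"
    then obtain k :: int where "x - y = 2 * pi * of_int k" by blast
    then have "y - x = 2 * pi * of_int (- k)" by (simp add: algebra_simps)
    then show "\<exists>k::int. y - x = 2 * pi * of_int k" by blast
  qed
  show "transp (\<lambda>x y. \<exists>k::int. x - y = 2 * pi * of_int k)"
  proof (rule transpI)
    fix x y z :: real
    assume "\<exists>k::int. x - y = 2 * pi * of_int k" and "\<exists>k::int. y - z = 2 * pi * of_int k"
    then obtain k l :: int
      where "x - y = 2 * pi * of_int k" and "y - z = 2 * pi * of_int l" by blast
    then have "x - z = 2 * pi * of_int (k + l)" by (simp add: algebra_simps)
    then show "\<exists>k::int. x - z = 2 * pi * of_int k" by blast
  qed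
qed

instantiation circle :: topological_space
begin

definition open_circle :: "circle set \<Rightarrow> bool" where
  "open_circle U \<longleftrightarrow> open (abs_circle -` U)"

instance
  by standard (auto simp: open_circle_def vimage_Union intro!: open_UN)

end

lift_definition circle_exp :: "int \<Rightarrow> circle \<Rightarrow> complex" is
  "\<lambda>n \<theta>. exp (\<i> * of_int n * of_real \<theta>)"
proof -
  fix n :: int and x y :: real
  assume "\<exists>k::int. x - y = 2 * pi * of_int k"
  then obtain k :: int where "x - y = 2 * pi * of_int k" by blast
  then have "x = y + 2 * pi * of_int k" by simp
  then have "\<i> * of_int n * of_real x
      = \<i> * of_int n * of_real y + of_real (of_int (2 * (n * k)) * pi) * \<i>"
    by (simp add: algebra_simps)
  then show "exp (\<i> * of_int n * of_real x) = exp (\<i> * of_int n * complex_of_real y)"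
    unfolding exp_eq by blast
qed

text \<open>
  Positivity needs no hypothesis, since values of \<^typ>\<open>'a measure\<close> are extended non-negative reals.
\<close>

definition radon_measure :: "'a::topological_space measure \<Rightarrow> bool" where
  "radon_measure M \<longleftrightarrow>
     sets M = sets borel \<and>
     (\<forall>K. compact K \<longrightarrow> emeasure M K < \<infinity>) \<and>
     (\<forall>B \<in> sets M. emeasure M B = (SUP K \<in> {K. compact K \<and> K \<subseteq> B}. emeasure M K))"

definition fourier_coeff :: "circle measure \<Rightarrow> int \<Rightarrow> complex" where
  "fourier_coeff \<mu> n = (\<integral>\<theta>. circle_exp (- n) \<theta> \<partial>\<mu>)"

text \<open>
  The free unital semigroup on \<open>s\<^sub>1, \<dots>, s\<^sub>q\<close> is the set \<^term>\<open>lists {1..q}\<close> of words in the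
  indices of the generators, with concatenation \<open>@\<close> and neutral element \<open>[]\<close>.
\<close>

primrec word_op :: "(nat \<Rightarrow> 'h \<Rightarrow> 'h) \<Rightarrow> nat list \<Rightarrow> 'h \<Rightarrow> 'h" where
  "word_op A [] = id"
| "word_op A (i # w) = A i \<circ> word_op A w"

definition Gamma_kernel ::
  "(nat \<Rightarrow> 'h::complex_hilbert_space \<Rightarrow> 'h) \<Rightarrow> circle measure
     \<Rightarrow> nat list \<Rightarrow> nat list \<Rightarrow> 'h \<Rightarrow> 'h" where
  "Gamma_kernel A \<mu> u v =
     (if \<exists>w. u = w @ v then
        (\<lambda>h. fourier_coeff \<mu> (int (length u) - int (length v))
               *\<^sub>C word_op A (THE w. u = w @ v) h)
      else if \<exists>w. v = w @ u then
        (\<lambda>h. fourier_coeff \<mu> (int (length u) - int (length v))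
               *\<^sub>C cadjoint (word_op A (THE w. v = w @ u)) h)
      else (\<lambda>h. 0))"

definition positive_definite_kernel ::
  "'x set \<Rightarrow> ('x \<Rightarrow> 'x \<Rightarrow> 'h::complex_hilbert_space \<Rightarrow> 'h) \<Rightarrow> bool" where
  "positive_definite_kernel X K \<longleftrightarrow>
     (\<forall>(n::nat) u h. (\<forall>i<n. u i \<in> X) \<longrightarrow>
        (\<Sum>i<n. \<Sum>j<n. cinner (K (u i) (u j) (h j)) (h i)) \<in> \<real>\<^sub>\<ge>\<^sub>0)"

end

theory Submission
  imports Defs
begin

text \<open>
  The factor \<open>fourier_coeff \<mu> (|u| - |v|)\<close> is the integral over \<open>\<theta>\<close> of
  \<open>exp (- i |u| \<theta>) exp (i |v| \<theta>)\<close>. Hence the quadratic form of \<open>Gamma_kernel A \<mu>\<close> at the vectors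
  \<open>h\<^sub>i\<close> is the integral of the quadratic form of the kernel without that factor, \<open>word_kernel A\<close>,
  at the rotated vectors \<open>exp (i |u\<^sub>i| \<theta>) h\<^sub>i\<close>. It therefore suffices that \<open>word_kernel A\<close> is
  positive definite (\<open>positive_definite_word_kernel\<close>).

  For that kernel, the adjoints \<open>A\<^sub>k\<^sup>*\<close> form a row contraction, which has a dilation to isometries
  \<open>V\<^sub>k\<close> with orthogonal ranges, and the form at a finitely supported family \<open>h\<close> is
  \<open>\<parallel>f\<parallel>\<^sup>2\<close>, where \<open>f\<close> is the sum of the vectors \<open>V\<^sub>u h\<^sub>u\<close> and
  \<open>V\<^sub>u = V\<^sub>i\<^sub>n \<dots> V\<^sub>i\<^sub>1\<close> for the word \<open>u = i\<^sub>1 \<dots> i\<^sub>n\<close>. Sorting the words by their last letter gives \<open>f = h\<^sub>e + (\<Sum>k. V\<^sub>k f\<^sub>k)\<close>. Since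
  \<open>V\<^sub>k\<^sup>*\<close> acts on the original space as \<open>A\<^sub>k\<close>, completing squares yields
  \<open>\<parallel>f\<parallel>\<^sup>2 = (\<parallel>h\<^sub>e\<parallel>\<^sup>2 - (\<Sum>k. \<parallel>A\<^sub>k h\<^sub>e\<parallel>\<^sup>2)) + (\<Sum>k. \<parallel>f\<^sub>k + A\<^sub>k h\<^sub>e\<parallel>\<^sup>2)\<close>.
  The first bracket is nonnegative by hypothesis, and \<open>f\<^sub>k + A\<^sub>k h\<^sub>e\<close> comes from a family supported
  on shorter words. In this identity the dilation can be eliminated: \<open>word_form_Suc\<close> states it for
  the kernel itself and proves it by expanding both sides. Positivity then follows by induction on
  the length of the words.

  Adjoints of bounded operators come from the Riesz theorem \<open>riesz_real\<close>. The exchange of sum and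
  integral is justified because the circle is compact, so that a Radon measure on it is finite.
\<close>

section \<open>Complex Hilbert spaces\<close>

lemma cinner_add_right: "cinner x (y + z) = cinner x y + cinner x z"
  by (metis cinner_add_left cinner_commute complex_cnj_add)

lemma cinner_scaleC_right: "cinner x (a *\<^sub>C y) = cnj a * cinner x y"
  by (metis cinner_scaleC_left cinner_commute complex_cnj_mult)

lemma scaleC_zero_right [simp]: "a *\<^sub>C (0 :: 'h::complex_hilbert_space) = 0"
  using scaleC_add_right[of a "0 :: 'h" 0] by simp

lemma scaleC_zero_left [simp]: "0 *\<^sub>C (x :: 'h::complex_hilbert_space) = 0"
  using scaleC_add_left[of 0 0 x] by simp

lemma cinner_zero_left [simp]: "cinner 0 x = 0"
  using cinner_add_left[of 0 0 x] by simp

lemma cinner_zero_right [simp]: "cinner x 0 = 0"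
  using cinner_add_right[of x 0 0] by simp

lemma cinner_minus_left: "cinner (- x) y = - cinner x y"
  using cinner_add_left[of x "- x" y] by (simp add: eq_neg_iff_add_eq_0 add.commute)

lemma cinner_minus_right: "cinner x (- y) = - cinner x y"
  using cinner_add_right[of x y "- y"] by (simp add: eq_neg_iff_add_eq_0 add.commute)

lemma cinner_diff_left: "cinner (x - y) z = cinner x z - cinner y z"
  using cinner_add_left[of x "- y" z] by (simp add: cinner_minus_left)

lemma cinner_diff_right: "cinner x (y - z) = cinner x y - cinner x z"
  using cinner_add_right[of x y "- z"] by (simp add: cinner_minus_right)

lemma cinner_scaleR_left: "cinner (r *\<^sub>R x) y = of_real r * cinner x y"
  by (simp add: scaleR_scaleC cinner_scaleC_left)

lemma cinner_scaleR_right: "cinner x (r *\<^sub>R y) = of_real r * cinner x y"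
  by (simp add: scaleR_scaleC cinner_scaleC_right)

lemma cinner_sum_left: "cinner (sum f S) y = (\<Sum>i\<in>S. cinner (f i) y)"
  by (induction S rule: infinite_finite_induct) (simp_all add: cinner_add_left)

lemma cinner_sum_right: "cinner x (sum f S) = (\<Sum>i\<in>S. cinner x (f i))"
  by (induction S rule: infinite_finite_induct) (simp_all add: cinner_add_right)

lemma norm_sq_eq_cinner: "(norm x)\<^sup>2 = Re (cinner x x)"
  by (simp add: norm_eq_sqrt_cinner cinner_self_nonneg)

lemma cinner_self: "cinner x x = of_real ((norm x)\<^sup>2)"
proof -
  have "Im (cinner x x) = 0"
    using arg_cong[OF cinner_commute[of x x], of Im] by simp
  then show ?thesis
    by (simp add: complex_eq_iff norm_sq_eq_cinner)
qed

lemma norm_sq_add: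
  fixes x y :: "'h::complex_hilbert_space"
  shows "(norm (x + y))\<^sup>2 = (norm x)\<^sup>2 + 2 * Re (cinner x y) + (norm y)\<^sup>2"
proof -
  have "Re (cinner y x) = Re (cinner x y)"
    by (subst cinner_commute) simp
  then show ?thesis
    by (simp add: norm_sq_eq_cinner cinner_add_left cinner_add_right)
qed

lemma parallelogram:
  fixes x y :: "'h::complex_hilbert_space"
  shows "(norm (x - y))\<^sup>2 + (norm (x + y))\<^sup>2 = 2 * (norm x)\<^sup>2 + 2 * (norm y)\<^sup>2"
  using norm_sq_add[of x y] norm_sq_add[of x "- y"] by (simp add: cinner_minus_right)

lemma norm_cinner_le:
  fixes x y :: "'h::complex_hilbert_space"
  shows "norm (cinner x y) \<le> norm x * norm y"
proof (cases "y = 0")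
  case False
  let ?a = "cinner x y"
  define n where "n = (norm y)\<^sup>2"
  have "n > 0"
    using False by (simp add: n_def)
  \<comment> \<open>The vector is \<open>n\<close> times the component of \<open>x\<close> orthogonal to \<open>y\<close>.\<close>
  let ?z = "n *\<^sub>R x - ?a *\<^sub>C y"
  have yx: "cinner y x = cnj ?a"
    by (rule cinner_commute)
  have yy: "cinner y y = of_real n"
    by (simp only: cinner_self n_def)
  have "cinner ?z ?z = of_real (n * (n * (norm x)\<^sup>2 - (norm ?a)\<^sup>2))"
    by (simp add: cinner_diff_left cinner_diff_right cinner_scaleR_left cinner_scaleR_right
        cinner_scaleC_left cinner_scaleC_right yx yy cinner_self[of x] complex_norm_square
        algebra_simps del: of_real_power)
  then have "0 \<le> n * (n * (norm x)\<^sup>2 - (norm ?a)\<^sup>2)"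
    using cinner_self_nonneg[of ?z] by simp
  then have "(norm ?a)\<^sup>2 \<le> (norm x * norm y)\<^sup>2"
    using \<open>n > 0\<close> by (simp add: zero_le_mult_iff power_mult_distrib n_def mult.commute)
  then show ?thesis
    by (rule power2_le_imp_le) simp
qed simp

text \<open>
  The Riesz representation theorem for real functionals. The representing vector is the minimiser
  of \<open>F x = \<parallel>x\<parallel>\<^sup>2 - 2 \<phi> x\<close>: by the parallelogram law, points at which \<open>F\<close> is close to its infimum
  are close to each other, so a minimising sequence is Cauchy; the derivative of \<open>F\<close> in every
  direction vanishes at its limit.
\<close>

lemma riesz_real:
  fixes \<phi> :: "'h::complex_hilbert_space \<Rightarrow> real"
  assumes "bounded_linear \<phi>"
  shows "\<exists>m. \<forall>x. \<phi> x = Re (cinner x m)"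
proof -
  interpret \<phi>: bounded_linear \<phi> by fact
  define F where "F = (\<lambda>x. (norm x)\<^sup>2 - 2 * \<phi> x)"
  define d where "d = Inf (range F)"
  obtain K where K: "\<And>x. norm (\<phi> x) \<le> norm x * K"
    using \<phi>.bounded by blast
  have lower: "- K\<^sup>2 \<le> F x" for x
  proof -
    have "\<phi> x \<le> norm x * K"
      using K[of x] by simp
    moreover have "0 \<le> (norm x - K)\<^sup>2"
      by simp
    ultimately show ?thesis
      by (simp add: F_def power2_diff)
  qed
  then have bdd: "bdd_below (range F)"
    by (intro bdd_belowI2)
  have d_le: "d \<le> F x" for x
    unfolding d_def using bdd by (intro cInf_lower) auto
  have "\<exists>x. F x < d + 1 / real (Suc n)" for n
    using cInf_lessD[of "range F" "d + 1 / real (Suc n)"] by (auto simp: d_def)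
  then obtain X where X: "\<And>n. F (X n) < d + 1 / real (Suc n)"
    by metis
  have close: "(norm (x - y))\<^sup>2 \<le> 2 * (F x - d) + 2 * (F y - d)" for x y
  proof -
    have "(norm ((1/2) *\<^sub>R (x + y)))\<^sup>2 = (norm (x + y))\<^sup>2 / 4"
      by (simp add: power_divide)
    then have "F ((1/2) *\<^sub>R (x + y)) = (norm (x + y))\<^sup>2 / 4 - \<phi> x - \<phi> y"
      by (simp add: F_def \<phi>.scaleR \<phi>.add power_divide add_divide_distrib)
    then show ?thesis
      using d_le[of "(1/2) *\<^sub>R (x + y)"] parallelogram[of x y] by (simp add: F_def)
  qed
  have "Cauchy X"
  proof (rule metric_CauchyI)
    fix e :: real
    assume "e > 0"
    then have "0 < e\<^sup>2 / 4"
      by simp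
    then obtain N where N: "1 / real (Suc N) < e\<^sup>2 / 4"
      using nat_approx_posE by blast
    have "dist (X m) (X n) < e" if "m \<ge> N" "n \<ge> N" for m n
    proof -
      have F_close: "F (X j) - d < e\<^sup>2 / 4" if "j \<ge> N" for j
      proof -
        have "1 / real (Suc j) \<le> 1 / real (Suc N)"
          using that by (intro divide_left_mono) auto
        then show ?thesis
          using X[of j] N by linarith
      qed
      have "(norm (X m - X n))\<^sup>2 < e\<^sup>2"
        using close[of "X m" "X n"] F_close[OF \<open>m \<ge> N\<close>] F_close[OF \<open>n \<ge> N\<close>]
        by (simp add: field_simps)
      then show ?thesis
        using \<open>e > 0\<close> by (simp add: dist_norm power_less_imp_less_base)
    qed
    then show "\<exists>N. \<forall>m\<ge>N. \<forall>n\<ge>N. dist (X m) (X n) < e"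
      by blast
  qed
  then obtain m where m: "X \<longlonglongrightarrow> m"
    using Cauchy_convergent_iff convergent_def by blast
  have "(\<lambda>n. F (X n)) \<longlonglongrightarrow> F m"
    unfolding F_def by (intro tendsto_intros \<phi>.tendsto m)
  moreover have "(\<lambda>n. d + 1 / real (Suc n)) \<longlonglongrightarrow> d + 0"
    by (intro tendsto_add tendsto_const) (rule LIMSEQ_Suc, rule lim_1_over_n)
  ultimately have "F m \<le> d + 0"
    using X by (intro LIMSEQ_le[of _ "F m"]) (auto intro: less_imp_le)
  then have min: "F m \<le> F x" for x
    using d_le[of x] by simp
  have "\<phi> x = Re (cinner x m)" for x
  proof -
    define b where "b = Re (cinner x m) - \<phi> x"
    have quad: "0 \<le> t\<^sup>2 * (norm x)\<^sup>2 + 2 * t * b" for t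
    proof -
      have "F (t *\<^sub>R x + m) = F m + t\<^sup>2 * (norm x)\<^sup>2 + 2 * t * b"
        unfolding F_def norm_sq_add[of "t *\<^sub>R x" m]
        by (simp add: \<phi>.scaleR \<phi>.add cinner_scaleR_left b_def power_mult_distrib algebra_simps)
      then show ?thesis
        using min[of "t *\<^sub>R x + m"] by simp
    qed
    have "b = 0"
    proof (rule ccontr)
      assume "b \<noteq> 0"
      define c where "c = (norm x)\<^sup>2 + 1"
      have "c > 0"
        by (simp add: c_def add_nonneg_pos)
      \<comment> \<open>The minimiser of \<open>t\<^sup>2 c + 2 t b\<close>; the summand \<open>1\<close> in \<open>c\<close> covers \<open>x = 0\<close>.\<close>
      define t where "t = - b / c"
      have t: "t \<noteq> 0" "b = - t * c"
        using \<open>b \<noteq> 0\<close> \<open>c > 0\<close> by (simp_all add: t_def)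
      have "t\<^sup>2 * (norm x)\<^sup>2 + 2 * t * b = - (t\<^sup>2 * (c + 1))"
        by (simp add: t(2) c_def power2_eq_square algebra_simps)
      moreover have "t\<^sup>2 * (c + 1) > 0"
        using t(1) \<open>c > 0\<close> by (intro mult_pos_pos) auto
      ultimately show False
        using quad[of t] by simp
    qed
    then show ?thesis
      by (simp add: b_def)
  qed
  then show ?thesis
    by blast
qed

lemma cinner_ext_right:
  assumes "\<And>x. cinner x y = cinner x z"
  shows "y = z"
proof -
  have "cinner (y - z) (y - z) = 0"
    using assms by (simp add: cinner_diff_right)
  then show ?thesis
    by (simp add: cinner_self_eq_zero_iff)
qed

lemma bounded_clinear_bounded_linear: "bounded_clinear T \<Longrightarrow> bounded_linear T"
  by (simp add: bounded_clinear_def)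

lemma bounded_clinear_scaleC: "bounded_clinear T \<Longrightarrow> T (c *\<^sub>C x) = c *\<^sub>C T x"
  by (simp add: bounded_clinear_def)

lemma cadjoint_eqI:
  assumes "\<And>x y. cinner (T x) y = cinner x (S y)"
  shows "cadjoint T = S"
  unfolding cadjoint_def
proof (rule the_equality)
  fix S' assume "\<forall>x y. cinner (T x) y = cinner x (S' y)"
  then show "S' = S"
    by (intro ext cinner_ext_right) (simp add: assms[symmetric])
qed (use assms in blast)

lemma cinner_cadjoint:
  fixes T :: "'h::complex_hilbert_space \<Rightarrow> 'h"
  assumes T: "bounded_clinear T"
  shows "cinner (T x) y = cinner x (cadjoint T y)"
proof -
  interpret T: bounded_linear T
    using T by (rule bounded_clinear_bounded_linear)
  have "\<exists>m. \<forall>x. cinner (T x) y = cinner x m" for y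
  proof -
    obtain K where K: "\<And>x. norm (T x) \<le> norm x * K"
      using T.bounded by blast
    have "bounded_linear (\<lambda>x. Re (cinner (T x) y))"
    proof (rule bounded_linear_intro[where K = "K * norm y"])
      fix x
      have "norm (Re (cinner (T x) y)) \<le> norm (T x) * norm y"
        using abs_Re_le_cmod norm_cinner_le order_trans by (metis real_norm_def)
      also have "\<dots> \<le> norm x * K * norm y"
        by (intro mult_right_mono K) simp
      finally show "norm (Re (cinner (T x) y)) \<le> norm x * (K * norm y)"
        by (simp add: mult.assoc)
    qed (simp_all add: T.add T.scaleR cinner_add_left cinner_scaleR_left)
    then obtain m where m: "\<And>x. Re (cinner (T x) y) = Re (cinner x m)"
      using riesz_real by blast
    \<comment> \<open>Replacing \<open>x\<close> by \<open>\<i> x\<close> turns the real parts into imaginary parts.\<close>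
    have "Im (cinner (T x) y) = Im (cinner x m)" for x
      using m[of "\<i> *\<^sub>C x"] by (simp add: bounded_clinear_scaleC[OF T] cinner_scaleC_left)
    with m show ?thesis
      by (auto simp: complex_eq_iff)
  qed
  then obtain S where S: "\<And>x y. cinner (T x) y = cinner x (S y)"
    by metis
  then show ?thesis
    using cadjoint_eqI[OF S] by simp
qed

text \<open>
  Boundedness comes from \<open>\<parallel>T\<^sup>* x\<parallel>\<^sup>2 = \<langle>T T\<^sup>* x, x\<rangle> \<le> K \<parallel>T\<^sup>* x\<parallel> \<parallel>x\<parallel>\<close>.
\<close>

lemma bounded_clinear_cadjoint:
  fixes T :: "'h::complex_hilbert_space \<Rightarrow> 'h"
  assumes T: "bounded_clinear T"
  shows "bounded_clinear (cadjoint T)"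
proof -
  note adj = cinner_cadjoint[OF T, symmetric]
  obtain K where K: "\<And>x. norm (T x) \<le> norm x * K" and "K \<ge> 0"
    using bounded_linear.nonneg_bounded[OF bounded_clinear_bounded_linear[OF T]] by blast
  have scale: "cadjoint T (c *\<^sub>C x) = c *\<^sub>C cadjoint T x" for c x
    by (rule cinner_ext_right) (simp add: adj cinner_scaleC_right)
  have "bounded_linear (cadjoint T)"
  proof (rule bounded_linear_intro[where K = K])
    fix x
    let ?y = "cadjoint T x"
    have "(norm ?y)\<^sup>2 = norm (cinner (T ?y) x)"
      unfolding adj[symmetric] by (simp add: cinner_self norm_power)
    also have "\<dots> \<le> norm (T ?y) * norm x"
      by (rule norm_cinner_le)
    also have "\<dots> \<le> norm ?y * K * norm x"
      by (intro mult_right_mono K) simp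
    finally have "norm ?y * norm ?y \<le> norm ?y * (norm x * K)"
      by (simp add: power2_eq_square mult_ac)
    then show "norm ?y \<le> norm x * K"
      using \<open>K \<ge> 0\<close> by (cases "?y = 0") auto
  qed (simp_all add: scaleR_scaleC scale, rule cinner_ext_right, simp add: adj cinner_add_right)
  then show ?thesis
    by (simp add: bounded_clinear_def scale)
qed

text \<open>
  The operator \<open>\<Sum>k. A\<^sub>k\<^sup>* A\<^sub>k\<close> turns into a pointwise estimate because its quadratic form is
  \<open>\<Sum>k. \<parallel>A\<^sub>k x\<parallel>\<^sup>2\<close>. The norm \<open>onorm\<close> controls its values because
  the adjoints are bounded.
\<close>

lemma column_contraction:
  fixes A :: "nat \<Rightarrow> 'h::complex_hilbert_space \<Rightarrow> 'h"
  assumes A: "\<forall>k\<in>I. bounded_clinear (A k)"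
    and le: "onorm (\<lambda>x. \<Sum>k\<in>I. cadjoint (A k) (A k x)) \<le> 1"
  shows "(\<Sum>k\<in>I. (norm (A k x))\<^sup>2) \<le> (norm x)\<^sup>2"
proof -
  let ?P = "\<lambda>x. \<Sum>k\<in>I. cadjoint (A k) (A k x)"
  have "bounded_linear ?P"
    by (intro bounded_linear_sum
        bounded_linear_compose[of "cadjoint (A k)" "A k" for k] bounded_clinear_bounded_linear
        bounded_clinear_cadjoint A[rule_format])
  then have "norm (?P x) \<le> norm x"
    using onorm[of ?P x] mult_right_mono[OF le norm_ge_zero[of x]] by simp
  have "complex_of_real (\<Sum>k\<in>I. (norm (A k x))\<^sup>2) = (\<Sum>k\<in>I. cinner (A k x) (A k x))"
    by (simp add: cinner_self)
  also have "\<dots> = cinner x (?P x)"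
    by (simp add: cinner_sum_right cinner_cadjoint A)
  finally have "\<bar>\<Sum>k\<in>I. (norm (A k x))\<^sup>2\<bar> = norm (cinner x (?P x))"
    by (metis norm_of_real)
  also have "\<dots> \<le> norm x * norm x"
    using norm_cinner_le[of x "?P x"] mult_left_mono[OF \<open>norm (?P x) \<le> norm x\<close> norm_ge_zero[of x]]
    by linarith
  finally show ?thesis
    by (simp add: power2_eq_square)
qed

section \<open>The kernel of words\<close>

lemma word_op_append: "word_op A (u @ v) x = word_op A u (word_op A v x)"
  by (induction u) simp_all

lemma bounded_clinear_word_op:
  assumes A: "\<forall>k\<in>I. bounded_clinear (A k)" and "w \<in> lists I"
  shows "bounded_clinear (word_op A w)"
  using assms(2)
proof (induction w)
  case Nil
  then show ?case by (simp add: bounded_clinear_def bounded_linear_ident id_def)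
next
  case (Cons k w)
  have Ak: "bounded_clinear (A k)" and IH: "bounded_clinear (word_op A w)"
    using Cons A by auto
  then have "bounded_linear (\<lambda>x. A k (word_op A w x))"
    using bounded_linear_compose bounded_clinear_bounded_linear by blast
  then show ?case
    using bounded_clinear_scaleC[OF Ak] bounded_clinear_scaleC[OF IH]
    by (simp add: bounded_clinear_def o_def)
qed

text \<open>
  This is \<^const>\<open>Gamma_kernel\<close> with all Fourier coefficients replaced by \<open>1\<close>, that is, for the
  unit mass at the neutral element of the circle.
\<close>

definition word_kernel ::
  "(nat \<Rightarrow> 'h::complex_hilbert_space \<Rightarrow> 'h) \<Rightarrow> nat list \<Rightarrow> nat list \<Rightarrow> 'h \<Rightarrow> 'h" where
  "word_kernel A u v =
     (if \<exists>w. u = w @ v then word_op A (THE w. u = w @ v)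
      else if \<exists>w. v = w @ u then cadjoint (word_op A (THE w. v = w @ u))
      else (\<lambda>h. 0))"

lemma Gamma_kernel_eq:
  "Gamma_kernel A \<mu> u v h
     = fourier_coeff \<mu> (int (length u) - int (length v)) *\<^sub>C word_kernel A u v h"
  unfolding Gamma_kernel_def word_kernel_def by (simp only: scaleC_zero_right split: if_split) simp

lemma word_kernel_left: "word_kernel A (w @ v) v = word_op A w"
  by (simp add: word_kernel_def)

lemma cadjoint_id: "cadjoint id = id"
  by (rule cadjoint_eqI) simp

lemma word_kernel_right: "word_kernel A v (w @ v) = cadjoint (word_op A w)"
proof (cases "w = []")
  case True
  then show ?thesis
    using word_kernel_left[of A "[]" v] by (simp add: cadjoint_id)
next
  case False
  then show ?thesis
    by (auto simp: word_kernel_def)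
qed

lemma word_kernel_incomparable:
  assumes "\<nexists>w. u = w @ v" "\<nexists>w. v = w @ u"
  shows "word_kernel A u v = (\<lambda>h. 0)"
  using assms by (simp add: word_kernel_def)

text \<open>
  Comparability in the kernel is by suffixes, so removing a common last letter changes nothing, and
  words with distinct last letters are never comparable. These two facts are what makes the form
  split along the last letter.
\<close>

lemma word_kernel_snoc_same: "word_kernel A (u @ [k]) (v @ [k]) = word_kernel A u v"
proof -
  have "(x @ [k] = w @ y @ [k]) = (x = w @ y)" for x w y :: "nat list"
    by (simp flip: append_assoc)
  then show ?thesis
    by (simp add: word_kernel_def)
qed

lemma word_kernel_snoc_distinct:
  assumes "k \<noteq> l"
  shows "word_kernel A (u @ [k]) (v @ [l]) = (\<lambda>h. 0)"
proof (rule word_kernel_incomparable)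
  have "x @ [a] \<noteq> w @ y @ [b]" if "a \<noteq> b" for x w y :: "nat list" and a b
    using that by (simp flip: append_assoc)
  then show "\<nexists>w. u @ [k] = w @ v @ [l]" "\<nexists>w. v @ [l] = w @ u @ [k]"
    using assms by metis+
qed

lemma word_kernel_Nil_right: "word_kernel A w [] = word_op A w"
  using word_kernel_left[of A w "[]"] by simp

lemma bounded_clinear_word_kernel:
  assumes A: "\<forall>k\<in>I. bounded_clinear (A k)"
    and "u \<in> lists I" "v \<in> lists I"
  shows "bounded_clinear (word_kernel A u v)"
proof -
  consider (left) w where "u = w @ v" | (right) w where "v = w @ u"
    | (none) "\<nexists>w. u = w @ v" "\<nexists>w. v = w @ u"
    by blast
  then show ?thesis
  proof cases
    case left
    with assms show ?thesis
      by (simp add: word_kernel_left bounded_clinear_word_op[OF A])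
  next
    case right
    with assms show ?thesis
      by (simp add: word_kernel_right bounded_clinear_cadjoint bounded_clinear_word_op[OF A])
  next
    case none
    then show ?thesis
      by (simp add: word_kernel_incomparable bounded_clinear_def)
  qed
qed

text \<open>
  This symmetry expresses the first row of the kernel through its first column, whose entries
  \<open>word_kernel A w []\<close> involve no adjoints.
\<close>

lemma word_kernel_hermitian:
  assumes A: "\<forall>k\<in>I. bounded_clinear (A k)"
    and "u \<in> lists I" "v \<in> lists I"
  shows "cinner (word_kernel A u v x) y = cinner x (word_kernel A v u y)"
proof -
  have adj: "cinner (word_op A w a) b = cinner a (cadjoint (word_op A w) b)"
    if "w \<in> lists I" for w a b
    using that by (intro cinner_cadjoint bounded_clinear_word_op[OF A])
  consider (left) w where "u = w @ v" | (right) w where "v = w @ u"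
    | (none) "\<nexists>w. u = w @ v" "\<nexists>w. v = w @ u"
    by blast
  then show ?thesis
  proof cases
    case left
    with assms show ?thesis
      by (simp add: word_kernel_left word_kernel_right adj)
  next
    case right
    then have w: "w \<in> lists I"
      using assms by simp
    have "cinner (cadjoint (word_op A w) x) y = cinner x (word_op A w y)"
      using adj[OF w, of y x] by (metis cinner_commute)
    with right show ?thesis
      by (simp add: word_kernel_left word_kernel_right)
  next
    case none
    then show ?thesis
      by (simp add: word_kernel_incomparable)
  qed
qed

section \<open>Positivity of the kernel of words\<close>

definition short_words :: "'a set \<Rightarrow> nat \<Rightarrow> 'a list set" where
  "short_words I N = {w \<in> lists I. length w \<le> N}"

lemma finite_short_words: "finite I \<Longrightarrow> finite (short_words I N)"
  unfolding short_words_def lists_eq_set using finite_lists_length_le[of I N] by simp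

lemma Nil_short_words: "[] \<in> short_words I N"
  by (simp add: short_words_def)

lemma short_words_lists: "w \<in> short_words I N \<Longrightarrow> w \<in> lists I"
  by (simp add: short_words_def)

lemma sum_short_words_Suc:
  assumes "finite I"
  shows "(\<Sum>w\<in>short_words I (Suc N). f w) = f [] + (\<Sum>k\<in>I. \<Sum>w\<in>short_words I N. f (w @ [k]))"
proof -
  let ?snoc = "\<lambda>(k, w). w @ [k]" and ?D = "I \<times> short_words I N"
  have eq: "short_words I (Suc N) = insert [] (?snoc ` ?D)"
  proof (intro equalityI subsetI)
    fix w assume "w \<in> short_words I (Suc N)"
    then show "w \<in> insert [] (?snoc ` ?D)"
      by (cases w rule: rev_cases) (force simp: short_words_def)+
  qed (auto simp: short_words_def)
  have "inj_on ?snoc ?D"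
    by (auto simp: inj_on_def)
  then have "sum f (?snoc ` ?D) = (\<Sum>k\<in>I. \<Sum>w\<in>short_words I N. f (w @ [k]))"
    by (simp add: sum.reindex sum.cartesian_product case_prod_unfold)
  moreover have "[] \<notin> ?snoc ` ?D"
    by auto
  ultimately show ?thesis
    unfolding eq using assms by (simp add: finite_short_words)
qed

lemma sum_nonneg_Reals:
  assumes "\<And>i. i \<in> S \<Longrightarrow> f i \<in> \<real>\<^sub>\<ge>\<^sub>0"
  shows "sum f S \<in> (\<real>\<^sub>\<ge>\<^sub>0 :: complex set)"
  using assms by (induction S rule: infinite_finite_induct) auto

definition word_form ::
  "(nat \<Rightarrow> 'h::complex_hilbert_space \<Rightarrow> 'h) \<Rightarrow> nat list set \<Rightarrow> (nat list \<Rightarrow> 'h) \<Rightarrow> complex" where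
  "word_form A W h = (\<Sum>u\<in>W. \<Sum>v\<in>W. cinner (word_kernel A u v (h v)) (h u))"

text \<open>
  The added vector sits at the empty word, so the cross terms involve only the first row and the
  first column of the kernel, which consist of the operators of \<open>A\<close> and their adjoints.
\<close>

lemma word_form_add_root:
  fixes A :: "nat \<Rightarrow> 'h::complex_hilbert_space \<Rightarrow> 'h"
    and I :: "nat set" and N :: nat
  assumes A: "\<forall>k\<in>I. bounded_clinear (A k)" and "finite I"
  defines "W \<equiv> short_words I N"
  shows "word_form A W (\<lambda>w. g w + (if w = [] then a else 0))
    = word_form A W g + (\<Sum>w\<in>W. cinner (word_op A w a) (g w))
      + (\<Sum>w\<in>W. cinner (g w) (word_op A w a)) + cinner a a"
proof -
  let ?d = "\<lambda>w :: nat list. if w = [] then a else 0"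
  have fin: "finite W" and Nil: "[] \<in> W"
    using assms by (simp_all add: finite_short_words Nil_short_words)
  have lin: "bounded_linear (word_kernel A u v)" if "u \<in> W" "v \<in> W" for u v
    using that bounded_clinear_word_kernel[OF A] short_words_lists
    unfolding W_def by (metis bounded_clinear_bounded_linear)
  have herm: "cinner (word_kernel A [] v x) y = cinner x (word_op A v y)" if "v \<in> W" for v x y
    using that word_kernel_hermitian[OF A, of "[]" v]
    by (simp add: W_def short_words_lists word_kernel_Nil_right)
  have kd: "cinner (word_kernel A u v (?d v)) y
      = (if v = [] then cinner (word_op A u a) y else 0)" if "u \<in> W" "v \<in> W" for u v y
    using linear_0[OF bounded_linear.linear[OF lin[OF that]]] by (simp add: word_kernel_Nil_right)
  have row: "(\<Sum>v\<in>W. cinner (word_kernel A u v (?d v)) y) = cinner (word_op A u a) y"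
    if "u \<in> W" for u y
    using that fin Nil by (simp add: kd cong: sum.cong)
  have cd: "cinner x (?d u) = (if u = [] then cinner x a else 0)" for x u
    by simp
  have "word_form A W (\<lambda>w. g w + ?d w)
    = (\<Sum>u\<in>W. \<Sum>v\<in>W. cinner (word_kernel A u v (g v)) (g u)
        + cinner (word_kernel A u v (?d v)) (g u)
        + (cinner (word_kernel A u v (g v)) (?d u)
        + cinner (word_kernel A u v (?d v)) (?d u)))"
    unfolding word_form_def
    by (intro sum.cong refl)
      (simp only: linear_add[OF bounded_linear.linear[OF lin]] cinner_add_left cinner_add_right
        add_ac)
  also have "\<dots> = word_form A W g
      + (\<Sum>u\<in>W. \<Sum>v\<in>W. cinner (word_kernel A u v (?d v)) (g u))
      + ((\<Sum>u\<in>W. \<Sum>v\<in>W. cinner (word_kernel A u v (g v)) (?d u))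
      + (\<Sum>u\<in>W. \<Sum>v\<in>W. cinner (word_kernel A u v (?d v)) (?d u)))"
    by (simp only: sum.distrib word_form_def)
  also have "(\<Sum>u\<in>W. \<Sum>v\<in>W. cinner (word_kernel A u v (?d v)) (g u))
      = (\<Sum>u\<in>W. cinner (word_op A u a) (g u))"
    by (intro sum.cong refl row)
  also have "(\<Sum>u\<in>W. \<Sum>v\<in>W. cinner (word_kernel A u v (g v)) (?d u))
      = (\<Sum>v\<in>W. cinner (g v) (word_op A v a))"
    using fin Nil by (subst sum.swap) (simp add: cd herm cong: sum.cong)
  also have "(\<Sum>u\<in>W. \<Sum>v\<in>W. cinner (word_kernel A u v (?d v)) (?d u)) = cinner a a"
  proof -
    have "(\<Sum>u\<in>W. \<Sum>v\<in>W. cinner (word_kernel A u v (?d v)) (?d u))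
        = (\<Sum>u\<in>W. cinner (word_op A u a) (?d u))"
      by (intro sum.cong refl row)
    also have "\<dots> = cinner a a"
      using fin Nil by (simp add: cd)
    finally show ?thesis .
  qed
  finally show ?thesis
    by (simp add: add_ac)
qed

text \<open>
  The key identity. Splitting off the empty word leaves one form for each last letter \<open>k\<close>, together
  with cross terms with \<open>h []\<close>. Since the operator of the word \<open>w k\<close> is that of \<open>w\<close> after \<open>A\<^sub>k\<close>,
  these are exactly the cross terms that \<open>word_form_add_root\<close> produces when \<open>A\<^sub>k (h [])\<close> is added at
  the empty word to the family \<open>w \<mapsto> h (w k)\<close>. The diagonal terms \<open>\<parallel>A\<^sub>k (h [])\<parallel>\<^sup>2\<close> that arise with
  them are subtracted from \<open>\<parallel>h []\<parallel>\<^sup>2\<close>.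
\<close>

lemma word_form_Suc:
  fixes A :: "nat \<Rightarrow> 'h::complex_hilbert_space \<Rightarrow> 'h"
    and I :: "nat set" and N :: nat
  assumes A: "\<forall>k\<in>I. bounded_clinear (A k)" and fin: "finite I"
  shows "word_form A (short_words I (Suc N)) h
    = of_real ((norm (h []))\<^sup>2 - (\<Sum>k\<in>I. (norm (A k (h [])))\<^sup>2))
      + (\<Sum>k\<in>I. word_form A (short_words I N)
          (\<lambda>w. h (w @ [k]) + (if w = [] then A k (h []) else 0)))"
proof -
  let ?W = "short_words I N"
  let ?c = "\<lambda>u v. cinner (word_kernel A u v (h v)) (h u)"
  have herm: "?c [] (w @ [k]) = cinner (h (w @ [k])) (word_op A w (A k (h [])))"
    if "w \<in> ?W" "k \<in> I" for w k
  proof -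
    have "w @ [k] \<in> lists I"
      using that by (simp add: short_words_def)
    then show ?thesis
      using word_kernel_hermitian[OF A, of "[]" "w @ [k]"]
      by (simp add: word_kernel_Nil_right word_op_append)
  qed
  have snoc: "(\<Sum>l\<in>I. \<Sum>v\<in>?W. ?c (w @ [k]) (v @ [l]))
      = (\<Sum>v\<in>?W. cinner (word_kernel A w v (h (v @ [k]))) (h (w @ [k])))"
    if "k \<in> I" for w k
  proof -
    have "(\<Sum>v\<in>?W. ?c (w @ [k]) (v @ [l])) = (if l = k
        then (\<Sum>v\<in>?W. cinner (word_kernel A w v (h (v @ [k]))) (h (w @ [k]))) else 0)" for l
      by (simp add: word_kernel_snoc_same word_kernel_snoc_distinct)
    then show ?thesis
      using that fin by simp
  qed
  have "word_form A (short_words I (Suc N)) h = ?c [] [] + (\<Sum>k\<in>I. \<Sum>w\<in>?W. ?c [] (w @ [k]))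
      + (\<Sum>k\<in>I. \<Sum>w\<in>?W. ?c (w @ [k]) [] + (\<Sum>l\<in>I. \<Sum>v\<in>?W. ?c (w @ [k]) (v @ [l])))"
    unfolding word_form_def using fin by (simp only: sum_short_words_Suc)
  also have "\<dots> = cinner (h []) (h [])
      + (\<Sum>k\<in>I. \<Sum>w\<in>?W. cinner (h (w @ [k])) (word_op A w (A k (h []))))
      + (\<Sum>k\<in>I. (\<Sum>w\<in>?W. cinner (word_op A w (A k (h []))) (h (w @ [k])))
          + word_form A ?W (\<lambda>w. h (w @ [k])))"
    by (simp add: herm snoc word_kernel_Nil_right word_op_append word_form_def sum.distrib
        cong: sum.cong)
  also have "\<dots> = cinner (h []) (h []) - (\<Sum>k\<in>I. cinner (A k (h [])) (A k (h [])))
      + (\<Sum>k\<in>I. word_form A ?W (\<lambda>w. h (w @ [k]) + (if w = [] then A k (h []) else 0)))"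
    by (simp add: word_form_add_root[OF A fin] sum.distrib)
  finally show ?thesis
    by (simp add: cinner_self)
qed

lemma word_form_nonneg:
  fixes A :: "nat \<Rightarrow> 'h::complex_hilbert_space \<Rightarrow> 'h"
  assumes A: "\<forall>k\<in>I. bounded_clinear (A k)" and fin: "finite I"
    and contr: "\<And>x. (\<Sum>k\<in>I. (norm (A k x))\<^sup>2) \<le> (norm x)\<^sup>2"
  shows "word_form A (short_words I N) h \<in> \<real>\<^sub>\<ge>\<^sub>0"
proof (induction N arbitrary: h)
  case 0
  have "short_words I 0 = {[]}"
    by (auto simp: short_words_def)
  then show ?case
    by (simp add: word_form_def word_kernel_Nil_right cinner_self del: of_real_power)
next
  case (Suc N)
  show ?case
    unfolding word_form_Suc[OF A fin]
    by (intro nonneg_Reals_add_I sum_nonneg_Reals Suc.IH)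
      (use contr[of "h []"] in \<open>simp del: of_real_diff\<close>)
qed

text \<open>
  In the definition of positive definiteness a word may occur several times. Adding the vectors
  that belong to the same word reduces it to \<^const>\<open>word_form\<close> on all words up to some length.
\<close>

lemma positive_definite_word_kernel:
  fixes A :: "nat \<Rightarrow> 'h::complex_hilbert_space \<Rightarrow> 'h"
  assumes A: "\<forall>k\<in>I. bounded_clinear (A k)" and fin: "finite I"
    and contr: "\<And>x. (\<Sum>k\<in>I. (norm (A k x))\<^sup>2) \<le> (norm x)\<^sup>2"
  shows "positive_definite_kernel (lists I) (word_kernel A)"
  unfolding positive_definite_kernel_def
proof (intro allI impI)
  fix n :: nat and u and h :: "nat \<Rightarrow> 'h"
  assume u: "\<forall>i<n. u i \<in> lists I"
  \<comment> \<open>The sum is an upper bound of the lengths that is also defined for \<open>n = 0\<close>.\<close>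
  define N where "N = (\<Sum>i<n. length (u i))"
  define W where "W = short_words I N"
  define g where "g = (\<lambda>w. \<Sum>i | i < n \<and> u i = w. h i)"
  have finW: "finite W"
    unfolding W_def using fin by (rule finite_short_words)
  have "length (u i) \<le> N" if "i < n" for i
    unfolding N_def using that by (intro member_le_sum) auto
  then have uW: "u ` {..<n} \<subseteq> W"
    using u by (auto simp: W_def short_words_def)
  have group: "(\<Sum>w\<in>W. \<Sum>i | i < n \<and> u i = w. f i) = (\<Sum>i<n. f i)" for f :: "nat \<Rightarrow> complex"
    using sum.group[OF finite_lessThan finW uW, of f] by simp
  have lin: "linear (word_kernel A v w)" if "v \<in> W" "w \<in> W" for v w
    using that bounded_clinear_word_kernel[OF A] short_words_lists
    unfolding W_def by (metis bounded_clinear_bounded_linear bounded_linear.linear)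
  have "word_form A W g
      = (\<Sum>v\<in>W. \<Sum>w\<in>W. \<Sum>j | j < n \<and> u j = w. \<Sum>i | i < n \<and> u i = v.
           cinner (word_kernel A (u i) (u j) (h j)) (h i))"
    unfolding word_form_def
  proof (intro sum.cong refl)
    fix v w assume "v \<in> W" "w \<in> W"
    then show "cinner (word_kernel A v w (g w)) (g v)
        = (\<Sum>j | j < n \<and> u j = w. \<Sum>i | i < n \<and> u i = v.
             cinner (word_kernel A (u i) (u j) (h j)) (h i))"
      by (subst sum.swap) (simp add: g_def linear_sum[OF lin] cinner_sum_left cinner_sum_right)
  qed
  also have "\<dots> = (\<Sum>v\<in>W. \<Sum>j<n. \<Sum>i | i < n \<and> u i = v. cinner (word_kernel A (u i) (u j) (h j)) (h i))"
    by (simp only: group)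
  also have "\<dots> = (\<Sum>j<n. \<Sum>v\<in>W. \<Sum>i | i < n \<and> u i = v. cinner (word_kernel A (u i) (u j) (h j)) (h i))"
    by (rule sum.swap)
  also have "\<dots> = (\<Sum>j<n. \<Sum>i<n. cinner (word_kernel A (u i) (u j) (h j)) (h i))"
    by (simp only: group)
  also have "\<dots> = (\<Sum>i<n. \<Sum>j<n. cinner (word_kernel A (u i) (u j) (h j)) (h i))"
    by (rule sum.swap)
  finally show "(\<Sum>i<n. \<Sum>j<n. cinner (word_kernel A (u i) (u j) (h j)) (h i)) \<in> \<real>\<^sub>\<ge>\<^sub>0"
    using word_form_nonneg[OF A fin contr, of N g] by (simp add: W_def)
qed

section \<open>Measures on the circle\<close>

lemma continuous_abs_circle: "continuous_on UNIV abs_circle"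
  by (simp add: continuous_on_open_vimage open_circle_def)

text \<open>
  The circle is the image of a period interval under the continuous quotient map.
\<close>

lemma compact_UNIV_circle: "compact (UNIV :: circle set)"
proof -
  have "x \<in> abs_circle ` {0..2 * pi}" for x
  proof (induction x rule: circle.abs_induct)
    case (1 t)
    let ?k = "\<lfloor>t / (2 * pi)\<rfloor>"
    let ?s = "t - 2 * pi * of_int ?k"
    have "?s \<in> {0..2 * pi}"
      using floor_divide_lower[of "2 * pi" t] floor_divide_upper[of "2 * pi" t]
      by (simp add: algebra_simps)
    moreover have "abs_circle t = abs_circle ?s"
      unfolding circle.abs_eq_iff by (rule exI[of _ ?k]) simp
    ultimately show ?case
      by blast
  qed
  then have "UNIV = abs_circle ` {0..2 * pi}"
    by blast
  then show ?thesis
    using compact_continuous_image[OF continuous_on_subset[OF continuous_abs_circle]]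
    by (metis compact_Icc subset_UNIV)
qed

lemma continuous_circle_exp: "continuous_on UNIV (circle_exp n)"
proof -
  have "continuous_on UNIV (\<lambda>t::real. exp (\<i> * of_int n * of_real t))"
    by (intro continuous_intros)
  then have "open (abs_circle -` (circle_exp n -` U))" if "open U" for U
    using that by (simp add: continuous_on_open_vimage vimage_def circle_exp.abs_eq)
  then show ?thesis
    by (simp add: continuous_on_open_vimage open_circle_def)
qed

lemma norm_circle_exp: "norm (circle_exp n x) = 1"
  by (induction x rule: circle.abs_induct) (simp add: circle_exp.abs_eq)

lemma circle_exp_diff: "circle_exp (m - n) x = circle_exp m x * cnj (circle_exp n x)"
  by (induction x rule: circle.abs_induct)
    (simp add: circle_exp.abs_eq exp_cnj algebra_simps flip: exp_add)

lemma radon_integrable_circle_exp: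
  assumes "radon_measure \<mu>"
  shows "integrable \<mu> (circle_exp n)"
proof -
  have sets: "sets \<mu> = sets borel" and fin: "emeasure \<mu> UNIV < \<infinity>"
    using assms compact_UNIV_circle by (auto simp: radon_measure_def)
  have "space \<mu> = UNIV"
    using sets_eq_imp_space_eq[OF sets] by simp
  then interpret finite_measure \<mu>
    using fin by (intro finite_measureI) simp
  have "circle_exp n \<in> borel_measurable \<mu>"
    unfolding measurable_cong_sets[OF sets refl]
    by (rule borel_measurable_continuous_onI[OF continuous_circle_exp])
  then show ?thesis
    by (intro integrable_const_bound[where B = 1]) (simp_all add: norm_circle_exp)
qed

lemma integral_nonneg_Reals:
  fixes f :: "'a \<Rightarrow> complex"
  assumes "\<And>x. f x \<in> \<real>\<^sub>\<ge>\<^sub>0"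
  shows "integral\<^sup>L M f \<in> \<real>\<^sub>\<ge>\<^sub>0"
proof -
  have "complex_of_real (Re (f x)) = f x" for x
    using assms[of x] by (simp add: complex_eq_iff complex_nonneg_Reals_iff)
  then have "integral\<^sup>L M f = of_real (integral\<^sup>L M (\<lambda>x. Re (f x)))"
    using integral_complex_of_real[of M "\<lambda>x. Re (f x)"] by simp
  moreover have "0 \<le> integral\<^sup>L M (\<lambda>x. Re (f x))"
    using assms by (intro Bochner_Integration.integral_nonneg) (simp add: complex_nonneg_Reals_iff)
  ultimately show ?thesis
    by simp
qed

theorem corollary1p14:
  fixes q :: nat
    and A :: "nat \<Rightarrow> 'h::complex_hilbert_space \<Rightarrow> 'h"
    and \<mu> :: "circle measure"
  assumes "q \<ge> 2"
    and "\<And>k. k \<in> {1..q} \<Longrightarrow> bounded_clinear (A k)"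
    and "onorm (\<lambda>x. \<Sum>k=1..q. cadjoint (A k) (A k x)) \<le> 1"
    and "radon_measure \<mu>"
  shows "positive_definite_kernel (lists {1..q}) (Gamma_kernel A \<mu>)"
  unfolding positive_definite_kernel_def
proof (intro allI impI)
  fix n :: nat and u and h :: "nat \<Rightarrow> 'h"
  assume u: "\<forall>i<n. u i \<in> lists {1..q}"
  let ?L = "\<lambda>i. int (length (u i))"
  let ?c = "\<lambda>i j. cinner (word_kernel A (u i) (u j) (h j)) (h i)"
  let ?f = "\<lambda>\<theta>. \<Sum>i<n. \<Sum>j<n. circle_exp (- (?L i - ?L j)) \<theta> * ?c i j"
  have A: "\<forall>k\<in>{1..q}. bounded_clinear (A k)"
    using assms(2) by blast
  have pd: "positive_definite_kernel (lists {1..q}) (word_kernel A)"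
    using column_contraction[OF A assms(3)]
    by (intro positive_definite_word_kernel[OF A]) simp_all
  have "?f \<theta> \<in> \<real>\<^sub>\<ge>\<^sub>0" for \<theta>
  proof -
    \<comment> \<open>The phase \<open>exp (- i (|u\<^sub>i| - |u\<^sub>j|) \<theta>)\<close> is distributed over the two vectors.\<close>
    define h' where "h' i = circle_exp (?L i) \<theta> *\<^sub>C h i" for i
    have "circle_exp (- (?L i - ?L j)) \<theta> * ?c i j
        = cinner (word_kernel A (u i) (u j) (h' j)) (h' i)" if "i < n" "j < n" for i j
    proof -
      have "bounded_clinear (word_kernel A (u i) (u j))"
        using u that by (intro bounded_clinear_word_kernel[OF A]) auto
      then show ?thesis
        by (simp add: h'_def bounded_clinear_scaleC cinner_scaleC_left cinner_scaleC_right
            circle_exp_diff)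
    qed
    then have "?f \<theta> = (\<Sum>i<n. \<Sum>j<n. cinner (word_kernel A (u i) (u j) (h' j)) (h' i))"
      by simp
    then show ?thesis
      using pd u by (simp add: positive_definite_kernel_def)
  qed
  then have "integral\<^sup>L \<mu> ?f \<in> \<real>\<^sub>\<ge>\<^sub>0"
    by (rule integral_nonneg_Reals)
  moreover have "integral\<^sup>L \<mu> ?f
      = (\<Sum>i<n. \<Sum>j<n. cinner (Gamma_kernel A \<mu> (u i) (u j) (h j)) (h i))"
    by (simp add: radon_integrable_circle_exp[OF assms(4)] Gamma_kernel_eq cinner_scaleC_left
        fourier_coeff_def)
  ultimately show "(\<Sum>i<n. \<Sum>j<n. cinner (Gamma_kernel A \<mu> (u i) (u j) (h j)) (h i)) \<in> \<real>\<^sub>\<ge>\<^sub>0"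
    by simp
qed

end
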